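(* Let $A$ and $B$ be two rings, $J$ an ideal of $B$, and let $f: A \to B$ be a ring homomorphism. Then $A \bowtie^{f} J$ is an SFT ring if and only if $A$ and $f(A)+J$ are both SFT rings.
   Context: All rings are commutative with identity. For a ring homomorphism $f: A \to B$ and an ideal $J$ of $B$, the amalgamation of $A$ with $B$ along $J$ with respect to $f$ is the subring $A \bowtie^{f} J := \{(a, f(a)+j) \mid a \in A,\ j \in J\}$ of $A \times B$. $f(A)+J := \{f(a)+j \mid a\in A,\ j \in J\}$ is a subring of $B$. An ideal $I$ of a ring $R$ is called an SFT ideal if there exist a positive integer $k$ and a finitely generated ideal $I' \subseteq I$ of $R$ such that $x^{k} \in I'$ for each $x \in I$. An SFT ring is a ring in which every ideal is an SFT ideal. *)

theory Defs
  imports "HOL-Algebra.Algebra"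
begin

definition finitely_generated_ideal :: "'a set \<Rightarrow> ('a, 'm) ring_scheme \<Rightarrow> bool" where
  "finitely_generated_ideal I R \<longleftrightarrow>
     (\<exists>S. finite S \<and> S \<subseteq> carrier R \<and> I = genideal R S)"

definition SFT_ideal :: "'a set \<Rightarrow> ('a, 'm) ring_scheme \<Rightarrow> bool" where
  "SFT_ideal I R \<longleftrightarrow> ideal I R \<and>
     (\<exists>(k::nat) I'. 0 < k \<and> finitely_generated_ideal I' R \<and> I' \<subseteq> I \<and>
        (\<forall>x\<in>I. x [^]\<^bsub>R\<^esub> k \<in> I'))"

locale SFT_ring = cring R for R (structure) +
  assumes all_ideals_SFT: "ideal I R \<Longrightarrow> SFT_ideal I R"

definition amalgamation ::
  "('a, 'm) ring_scheme \<Rightarrow> ('b, 'n) ring_scheme \<Rightarrow> ('a \<Rightarrow> 'b) \<Rightarrow> 'b set \<Rightarrow> ('a \<times> 'b) ring" where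
  "amalgamation A B f J = (RDirProd A B)
     \<lparr>carrier := {(a, f a \<oplus>\<^bsub>B\<^esub> j) | a j. a \<in> carrier A \<and> j \<in> J}\<rparr>"

definition image_plus_ideal ::
  "('a, 'm) ring_scheme \<Rightarrow> ('b, 'n) ring_scheme \<Rightarrow> ('a \<Rightarrow> 'b) \<Rightarrow> 'b set \<Rightarrow> ('b, 'n) ring_scheme" where
  "image_plus_ideal A B f J =
     B\<lparr>carrier := {f a \<oplus>\<^bsub>B\<^esub> j | a j. a \<in> carrier A \<and> j \<in> J}\<rparr>"

lemma subring_image_plus_ideal:
  assumes "cring A" "cring B" "ideal J B" "f \<in> ring_hom A B"
  shows "subring (carrier (image_plus_ideal A B f J)) B"
proof -
  interpret A: cring A by fact
  interpret B: cring B by fact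
  interpret J: ideal J B by fact
  interpret f: ring_hom_cring A B f
    by (intro ring_hom_cring.intro ring_hom_cring_axioms.intro) (use assms in auto)
  let ?H = "{f a \<oplus>\<^bsub>B\<^esub> j | a j. a \<in> carrier A \<and> j \<in> J}"
  have sub: "x \<in> carrier B" if "x \<in> J" for x
    using that J.a_subset by blast
  have "subring ?H B"
  proof (rule B.subringI)
    show "?H \<subseteq> carrier B" using sub by auto
    have "\<one>\<^bsub>B\<^esub> = f \<one>\<^bsub>A\<^esub> \<oplus>\<^bsub>B\<^esub> \<zero>\<^bsub>B\<^esub>" by simp
    then show "\<one>\<^bsub>B\<^esub> \<in> ?H" using A.one_closed J.zero_closed by blast
  next
    fix h assume "h \<in> ?H"
    then obtain a j where h: "h = f a \<oplus>\<^bsub>B\<^esub> j" "a \<in> carrier A" "j \<in> J" by blast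
    then have "\<ominus>\<^bsub>B\<^esub> h = f (\<ominus>\<^bsub>A\<^esub> a) \<oplus>\<^bsub>B\<^esub> \<ominus>\<^bsub>B\<^esub> j"
      by (simp add: sub B.minus_add)
    moreover have "\<ominus>\<^bsub>B\<^esub> j \<in> J" using h by simp
    ultimately show "\<ominus>\<^bsub>B\<^esub> h \<in> ?H" using h by blast
  next
    fix h1 h2 assume "h1 \<in> ?H" "h2 \<in> ?H"
    then obtain a j b i where h: "h1 = f a \<oplus>\<^bsub>B\<^esub> j" "a \<in> carrier A" "j \<in> J"
      "h2 = f b \<oplus>\<^bsub>B\<^esub> i" "b \<in> carrier A" "i \<in> J" by blast
    have "h1 \<otimes>\<^bsub>B\<^esub> h2 = f (a \<otimes>\<^bsub>A\<^esub> b) \<oplus>\<^bsub>B\<^esub> (f a \<otimes>\<^bsub>B\<^esub> i \<oplus>\<^bsub>B\<^esub> j \<otimes>\<^bsub>B\<^esub> (f b \<oplus>\<^bsub>B\<^esub> i))"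
      using h by (simp add: sub B.l_distr B.r_distr B.a_ac)
    moreover have "f a \<otimes>\<^bsub>B\<^esub> i \<oplus>\<^bsub>B\<^esub> j \<otimes>\<^bsub>B\<^esub> (f b \<oplus>\<^bsub>B\<^esub> i) \<in> J"
      using h sub by (intro J.a_closed J.I_l_closed J.I_r_closed) auto
    ultimately show "h1 \<otimes>\<^bsub>B\<^esub> h2 \<in> ?H" using h by blast
    have "h1 \<oplus>\<^bsub>B\<^esub> h2 = f (a \<oplus>\<^bsub>A\<^esub> b) \<oplus>\<^bsub>B\<^esub> (j \<oplus>\<^bsub>B\<^esub> i)"
      using h by (simp add: sub B.a_ac)
    moreover have "j \<oplus>\<^bsub>B\<^esub> i \<in> J" using h by simp
    ultimately show "h1 \<oplus>\<^bsub>B\<^esub> h2 \<in> ?H" using h by blast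
  qed
  then show ?thesis by (simp add: image_plus_ideal_def)
qed

lemma RDirProd_ops:
  "(a, b) \<oplus>\<^bsub>RDirProd R S\<^esub> (c, d) = (a \<oplus>\<^bsub>R\<^esub> c, b \<oplus>\<^bsub>S\<^esub> d)"
  "(a, b) \<otimes>\<^bsub>RDirProd R S\<^esub> (c, d) = (a \<otimes>\<^bsub>R\<^esub> c, b \<otimes>\<^bsub>S\<^esub> d)"
  "\<one>\<^bsub>RDirProd R S\<^esub> = (\<one>\<^bsub>R\<^esub>, \<one>\<^bsub>S\<^esub>)"
  "\<zero>\<^bsub>RDirProd R S\<^esub> = (\<zero>\<^bsub>R\<^esub>, \<zero>\<^bsub>S\<^esub>)"
  by (simp_all add: RDirProd_def DirProd_def monoid.defs)

lemma subring_amalgamation: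
  assumes "cring A" "cring B" "ideal J B" "f \<in> ring_hom A B"
  shows "subring (carrier (amalgamation A B f J)) (RDirProd A B)"
proof -
  interpret A: cring A by fact
  interpret B: cring B by fact
  interpret J: ideal J B by fact
  interpret f: ring_hom_cring A B f
    by (intro ring_hom_cring.intro ring_hom_cring_axioms.intro) (use assms in auto)
  interpret P: ring "RDirProd A B"
    by (rule RDirProd_ring) unfold_locales
  let ?H = "{(a, f a \<oplus>\<^bsub>B\<^esub> j) | a j. a \<in> carrier A \<and> j \<in> J}"
  have sub: "x \<in> carrier B" if "x \<in> J" for x
    using that J.a_subset by blast
  have "subring ?H (RDirProd A B)"
  proof (rule P.subringI)
    show "?H \<subseteq> carrier (RDirProd A B)" using sub by (auto simp: RDirProd_carrier)
    have "\<one>\<^bsub>RDirProd A B\<^esub> = (\<one>\<^bsub>A\<^esub>, f \<one>\<^bsub>A\<^esub> \<oplus>\<^bsub>B\<^esub> \<zero>\<^bsub>B\<^esub>)" by (simp add: RDirProd_ops)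
    then show "\<one>\<^bsub>RDirProd A B\<^esub> \<in> ?H" using A.one_closed J.zero_closed by blast
  next
    fix h assume "h \<in> ?H"
    then obtain a j where h: "h = (a, f a \<oplus>\<^bsub>B\<^esub> j)" "a \<in> carrier A" "j \<in> J" by blast
    let ?m = "(\<ominus>\<^bsub>A\<^esub> a, f (\<ominus>\<^bsub>A\<^esub> a) \<oplus>\<^bsub>B\<^esub> \<ominus>\<^bsub>B\<^esub> j)"
    have "f (\<ominus>\<^bsub>A\<^esub> a) \<oplus>\<^bsub>B\<^esub> \<ominus>\<^bsub>B\<^esub> j = \<ominus>\<^bsub>B\<^esub> (f a \<oplus>\<^bsub>B\<^esub> j)"
      using h by (simp add: sub B.minus_add)
    then have "?m \<oplus>\<^bsub>RDirProd A B\<^esub> h = \<zero>\<^bsub>RDirProd A B\<^esub>"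
      using h by (simp add: RDirProd_ops sub A.l_neg B.l_neg)
    then have "\<ominus>\<^bsub>RDirProd A B\<^esub> h = ?m"
      using h by (intro P.minus_equality) (auto simp: RDirProd_carrier sub)
    moreover have "\<ominus>\<^bsub>B\<^esub> j \<in> J" using h by simp
    ultimately show "\<ominus>\<^bsub>RDirProd A B\<^esub> h \<in> ?H" using h by blast
  next
    fix h1 h2 assume "h1 \<in> ?H" "h2 \<in> ?H"
    then obtain a j b i where h: "h1 = (a, f a \<oplus>\<^bsub>B\<^esub> j)" "a \<in> carrier A" "j \<in> J"
      "h2 = (b, f b \<oplus>\<^bsub>B\<^esub> i)" "b \<in> carrier A" "i \<in> J" by blast
    have "h1 \<otimes>\<^bsub>RDirProd A B\<^esub> h2 = (a \<otimes>\<^bsub>A\<^esub> b,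
        f (a \<otimes>\<^bsub>A\<^esub> b) \<oplus>\<^bsub>B\<^esub> (f a \<otimes>\<^bsub>B\<^esub> i \<oplus>\<^bsub>B\<^esub> j \<otimes>\<^bsub>B\<^esub> (f b \<oplus>\<^bsub>B\<^esub> i)))"
      using h by (simp add: RDirProd_ops sub B.l_distr B.r_distr B.a_ac)
    moreover have "f a \<otimes>\<^bsub>B\<^esub> i \<oplus>\<^bsub>B\<^esub> j \<otimes>\<^bsub>B\<^esub> (f b \<oplus>\<^bsub>B\<^esub> i) \<in> J"
      using h sub by (intro J.a_closed J.I_l_closed J.I_r_closed) auto
    ultimately show "h1 \<otimes>\<^bsub>RDirProd A B\<^esub> h2 \<in> ?H" using h by blast
    have "h1 \<oplus>\<^bsub>RDirProd A B\<^esub> h2 = (a \<oplus>\<^bsub>A\<^esub> b, f (a \<oplus>\<^bsub>A\<^esub> b) \<oplus>\<^bsub>B\<^esub> (j \<oplus>\<^bsub>B\<^esub> i))"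
      using h by (simp add: RDirProd_ops sub B.a_ac)
    moreover have "j \<oplus>\<^bsub>B\<^esub> i \<in> J" using h by simp
    ultimately show "h1 \<oplus>\<^bsub>RDirProd A B\<^esub> h2 \<in> ?H" using h by blast
  qed
  then show ?thesis by (simp add: amalgamation_def)
qed

end

theory Submission
  imports Defs
begin

text \<open>
  The amalgamation \<open>R\<close> of \<open>A\<close> with \<open>B\<close> along \<open>J\<close> projects onto \<open>A\<close> and onto \<open>f(A) + J\<close>. The SFT
  property passes along surjections, because the generators for the preimage of an
  ideal can be pushed forward while the exponent is kept
  (\<open>SFT_ring_surjective_image\<close>); this gives one direction.

  Conversely, the kernels of the two projections consist of pairs \<open>(0, j)\<close> and \<open>(a, 0)\<close>, so their
  product is zero. Let \<open>I\<close> be an ideal of \<open>R\<close>. The SFT property of the first image of \<open>I\<close> gives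
  \<open>x\<^sup>k = y + u\<close> for all \<open>x \<in> I\<close>, where \<open>y\<close> lies in a fixed finitely generated subideal of \<open>I\<close> and
  \<open>u\<close> in the first kernel; the second image gives likewise \<open>x\<^sup>m = z + v\<close>. Because \<open>u v = 0\<close>, the
  power \<open>x\<^sup>k\<^sup>+\<^sup>m = (y + u)(z + v)\<close> lies in the sum of the two finitely generated subideals
  (\<open>SFT_ring_if_kernels_annihilate\<close>).
\<close>

section \<open>Ideals and surjective ring homomorphisms\<close>

lemma (in ring_hom_ring) surjective_image_ideal:
  assumes surj: "h ` carrier R = carrier S" and I: "ideal I R"
  shows "ideal (h ` I) S"
proof (rule idealI)
  interpret I: ideal I R by fact
  show "ring S" by (rule S.ring_axioms)
  show "subgroup (h ` I) (add_monoid S)"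
    by (rule img_is_add_subgroup) (rule I.a_subgroup)
  fix a x assume "a \<in> h ` I" "x \<in> carrier S"
  then obtain b y where b: "b \<in> I" "a = h b" and y: "y \<in> carrier R" "x = h y"
    using surj by blast
  have bc: "b \<in> carrier R" using b(1) by (rule I.Icarr)
  have "x \<otimes>\<^bsub>S\<^esub> a = h (y \<otimes> b)" using b y bc by simp
  then show "x \<otimes>\<^bsub>S\<^esub> a \<in> h ` I" using I.I_l_closed[OF b(1) y(1)] by blast
  have "a \<otimes>\<^bsub>S\<^esub> x = h (b \<otimes> y)" using b y bc by simp
  then show "a \<otimes>\<^bsub>S\<^esub> x \<in> h ` I" using I.I_r_closed[OF b(1) y(1)] by blast
qed

lemma (in ring_hom_ring) image_genideal_subset:
  assumes T: "T \<subseteq> carrier R"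
  shows "h ` genideal R T \<subseteq> genideal S (h ` T)"
proof -
  have sub: "h ` T \<subseteq> carrier S" using T by auto
  have "ideal {r \<in> carrier R. h r \<in> genideal S (h ` T)} R"
    by (rule ideal_vimage) (rule S.genideal_ideal[OF sub])
  moreover have "T \<subseteq> {r \<in> carrier R. h r \<in> genideal S (h ` T)}"
    using T S.genideal_self[OF sub] by auto
  ultimately show ?thesis
    using R.genideal_minimal by blast
qed

lemma (in ring_hom_ring) genideal_image_subset:
  assumes surj: "h ` carrier R = carrier S" and T: "T \<subseteq> carrier R"
  shows "genideal S (h ` T) \<subseteq> h ` genideal R T"
  using surjective_image_ideal[OF surj R.genideal_ideal[OF T]] R.genideal_self[OF T]
  by (intro S.genideal_minimal) auto

section \<open>The SFT property and surjections\<close>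

lemma SFT_ring_surjective_image:
  assumes "SFT_ring R" and "cring S" and h: "h \<in> ring_hom R S"
    and surj: "h ` carrier R = carrier S"
  shows "SFT_ring S"
proof -
  interpret R: SFT_ring R by fact
  interpret S: cring S by fact
  interpret h: ring_hom_cring R S h
    by unfold_locales (rule h)
  show ?thesis
  proof
    fix I assume I: "ideal I S"
    interpret I: ideal I S by fact
    let ?P = "{r \<in> carrier R. h r \<in> I}"
    have "SFT_ideal ?P R"
      by (rule R.all_ideals_SFT) (rule h.ring.ideal_vimage[OF I])
    then obtain k :: nat and T where k: "0 < k" and T: "finite T" "T \<subseteq> carrier R"
      and TP: "genideal R T \<subseteq> ?P" and pow: "\<forall>x\<in>?P. x [^]\<^bsub>R\<^esub> k \<in> genideal R T"
      unfolding SFT_ideal_def finitely_generated_ideal_def by blast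
    have "finitely_generated_ideal (genideal S (h ` T)) S"
      unfolding finitely_generated_ideal_def using T by (intro exI[of _ "h ` T"]) auto
    moreover have "genideal S (h ` T) \<subseteq> I"
      using TP R.genideal_self[OF T(2)] by (intro S.genideal_minimal[OF I]) auto
    moreover have "\<forall>y\<in>I. y [^]\<^bsub>S\<^esub> k \<in> genideal S (h ` T)"
    proof
      fix y assume y: "y \<in> I"
      then obtain x where x: "x \<in> carrier R" "y = h x"
        using surj I.Icarr by blast
      then have "x [^]\<^bsub>R\<^esub> k \<in> genideal R T" using pow y by simp
      then have "h (x [^]\<^bsub>R\<^esub> k) \<in> genideal S (h ` T)"
        using h.ring.image_genideal_subset[OF T(2)] by blast
      then show "y [^]\<^bsub>S\<^esub> k \<in> genideal S (h ` T)" using x by simp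
    qed
    ultimately show "SFT_ideal I S"
      unfolding SFT_ideal_def using I k by blast
  qed
qed

text \<open>
  The image of \<open>I\<close> is an SFT ideal, and the finitely many generators of its subideal lift to \<open>I\<close>.
  This is the SFT condition for \<open>I\<close> up to an error in the kernel.
\<close>

lemma SFT_ideal_modulo_kernel:
  assumes "cring R" and "SFT_ring S" and h: "h \<in> ring_hom R S"
    and surj: "h ` carrier R = carrier S" and I: "ideal I R"
  obtains k :: nat and T where "0 < k" "finite T" "T \<subseteq> I"
    "\<forall>x\<in>I. \<exists>y\<in>genideal R T. h (x [^]\<^bsub>R\<^esub> k \<ominus>\<^bsub>R\<^esub> y) = \<zero>\<^bsub>S\<^esub>"
proof -
  interpret R: cring R by fact
  interpret S: SFT_ring S by fact
  interpret h: ring_hom_cring R S h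
    by unfold_locales (rule h)
  interpret I: ideal I R by fact
  have "SFT_ideal (h ` I) S"
    by (rule S.all_ideals_SFT) (rule h.ring.surjective_image_ideal[OF surj I])
  then obtain k :: nat and U where k: "0 < k" and U: "finite U" "U \<subseteq> carrier S"
    and UI: "genideal S U \<subseteq> h ` I" and pow: "\<forall>y\<in>h ` I. y [^]\<^bsub>S\<^esub> k \<in> genideal S U"
    unfolding SFT_ideal_def finitely_generated_ideal_def by blast
  have "U \<subseteq> h ` I" using UI S.genideal_self[OF U(2)] by blast
  then obtain T where T: "T \<subseteq> I" "finite T" "U = h ` T"
    using finite_subset_image[OF U(1)] by blast
  have Tc: "T \<subseteq> carrier R" using T(1) I.Icarr by blast
  interpret T: ideal "genideal R T" R by (rule R.genideal_ideal[OF Tc])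
  have "\<exists>y\<in>genideal R T. h (x [^]\<^bsub>R\<^esub> k \<ominus>\<^bsub>R\<^esub> y) = \<zero>\<^bsub>S\<^esub>" if x: "x \<in> I" for x
  proof -
    have xc: "x \<in> carrier R" using x by (rule I.Icarr)
    have "h x [^]\<^bsub>S\<^esub> k \<in> genideal S U" using pow x by blast
    then obtain y where y: "y \<in> genideal R T" "h x [^]\<^bsub>S\<^esub> k = h y"
      using h.ring.genideal_image_subset[OF surj Tc] T(3) by blast
    have yc: "y \<in> carrier R" using y(1) by (rule T.Icarr)
    have "h (x [^]\<^bsub>R\<^esub> k \<ominus>\<^bsub>R\<^esub> y) = \<zero>\<^bsub>S\<^esub>"
      using xc yc y(2) by (simp add: R.minus_eq S.r_neg)
    then show ?thesis using y(1) by blast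
  qed
  then show thesis using that k T by blast
qed

text \<open>
  The exponents for the two images add up: if \<open>x\<^sup>k\<close> and \<open>x\<^sup>m\<close> lie in the finitely generated subideal
  up to errors \<open>u\<close> and \<open>v\<close> from the two kernels, then the only term of the product outside it is
  \<open>u v = 0\<close>.
\<close>

lemma SFT_ring_if_kernels_annihilate:
  assumes "cring R" and A: "SFT_ring A" and C: "SFT_ring C"
    and p: "p \<in> ring_hom R A" "p ` carrier R = carrier A"
    and q: "q \<in> ring_hom R C" "q ` carrier R = carrier C"
    and ann: "\<And>u v. u \<in> carrier R \<Longrightarrow> v \<in> carrier R \<Longrightarrow> p u = \<zero>\<^bsub>A\<^esub> \<Longrightarrow> q v = \<zero>\<^bsub>C\<^esub> \<Longrightarrow>
      u \<otimes>\<^bsub>R\<^esub> v = \<zero>\<^bsub>R\<^esub>"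
  shows "SFT_ring R"
proof -
  interpret R: cring R by fact
  show ?thesis
  proof
    fix I assume I: "ideal I R"
    interpret I: ideal I R by fact
    obtain k :: nat and T where k: "0 < k" and T: "finite T" "T \<subseteq> I"
      and kT: "\<forall>x\<in>I. \<exists>y\<in>genideal R T. p (x [^]\<^bsub>R\<^esub> k \<ominus>\<^bsub>R\<^esub> y) = \<zero>\<^bsub>A\<^esub>"
      using SFT_ideal_modulo_kernel[OF \<open>cring R\<close> A p I] .
    obtain m :: nat and U where U: "finite U" "U \<subseteq> I"
      and mU: "\<forall>x\<in>I. \<exists>z\<in>genideal R U. q (x [^]\<^bsub>R\<^esub> m \<ominus>\<^bsub>R\<^esub> z) = \<zero>\<^bsub>C\<^esub>"
      using SFT_ideal_modulo_kernel[OF \<open>cring R\<close> C q I] .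
    let ?G = "genideal R (T \<union> U)"
    have TUc: "T \<union> U \<subseteq> carrier R" using T U I.Icarr by blast
    interpret G: ideal ?G R by (rule R.genideal_ideal[OF TUc])
    have TG: "genideal R T \<subseteq> ?G" and UG: "genideal R U \<subseteq> ?G"
      using R.subset_Idl_subset[OF TUc] by auto
    have "finitely_generated_ideal ?G R"
      unfolding finitely_generated_ideal_def using T U TUc by blast
    moreover have "?G \<subseteq> I"
      using T U by (intro R.genideal_minimal[OF I]) auto
    moreover have "\<forall>x\<in>I. x [^]\<^bsub>R\<^esub> (k + m) \<in> ?G"
    proof
      fix x assume x: "x \<in> I"
      obtain y where y: "y \<in> ?G" and py: "p (x [^]\<^bsub>R\<^esub> k \<ominus>\<^bsub>R\<^esub> y) = \<zero>\<^bsub>A\<^esub>"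
        using kT x TG by blast
      obtain z where z: "z \<in> ?G" and qz: "q (x [^]\<^bsub>R\<^esub> m \<ominus>\<^bsub>R\<^esub> z) = \<zero>\<^bsub>C\<^esub>"
        using mU x UG by blast
      define u where "u = x [^]\<^bsub>R\<^esub> k \<ominus>\<^bsub>R\<^esub> y"
      define v where "v = x [^]\<^bsub>R\<^esub> m \<ominus>\<^bsub>R\<^esub> z"
      have c: "x \<in> carrier R" "y \<in> carrier R" "z \<in> carrier R"
        using x y z I.Icarr G.Icarr by auto
      have uv: "u \<in> carrier R" "v \<in> carrier R" using c by (auto simp: u_def v_def)
      have "u \<otimes>\<^bsub>R\<^esub> v = \<zero>\<^bsub>R\<^esub>"
        using ann uv py qz by (simp add: u_def v_def)
      moreover have "x [^]\<^bsub>R\<^esub> k = u \<oplus>\<^bsub>R\<^esub> y" "x [^]\<^bsub>R\<^esub> m = v \<oplus>\<^bsub>R\<^esub> z"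
        using c by (simp_all add: u_def v_def R.minus_eq R.a_assoc R.l_neg)
      ultimately have "x [^]\<^bsub>R\<^esub> (k + m) = u \<otimes>\<^bsub>R\<^esub> z \<oplus>\<^bsub>R\<^esub> y \<otimes>\<^bsub>R\<^esub> (v \<oplus>\<^bsub>R\<^esub> z)"
        using c uv by (simp add: R.nat_pow_mult[symmetric] R.l_distr R.r_distr R.a_lcomm)
      then show "x [^]\<^bsub>R\<^esub> (k + m) \<in> ?G"
        using y z c uv by (simp add: G.I_l_closed G.I_r_closed)
    qed
    ultimately show "SFT_ideal I R"
      unfolding SFT_ideal_def using I k
      by (intro conjI exI[of _ "k + m"] exI[of _ ?G]) auto
  qed
qed

section \<open>The amalgamation\<close>

lemma cring_image_plus_ideal:
  assumes "cring A" "cring B" "ideal J B" "f \<in> ring_hom A B"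
  shows "cring (image_plus_ideal A B f J)"
proof -
  interpret B: cring B by fact
  have sub: "subring (carrier (image_plus_ideal A B f J)) B"
    by (rule subring_image_plus_ideal[OF assms])
  show ?thesis
    using B.subcring_iff[OF subringE(1)[OF sub]] B.subcringI'[OF sub]
    by (simp add: image_plus_ideal_def)
qed

lemma cring_amalgamation:
  assumes "cring A" "cring B" "ideal J B" "f \<in> ring_hom A B"
  shows "cring (amalgamation A B f J)"
proof -
  interpret A: cring A by fact
  interpret B: cring B by fact
  interpret P: ring "RDirProd A B"
    by (rule RDirProd_ring) unfold_locales
  have sub: "subring (carrier (amalgamation A B f J)) (RDirProd A B)"
    by (rule subring_amalgamation[OF assms])
  have "subcring (carrier (amalgamation A B f J)) (RDirProd A B)"
  proof (rule P.subcringI[OF sub])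
    fix x y
    assume "x \<in> carrier (amalgamation A B f J)" "y \<in> carrier (amalgamation A B f J)"
    then have "x \<in> carrier A \<times> carrier B" "y \<in> carrier A \<times> carrier B"
      using subringE(1)[OF sub] by (auto simp: RDirProd_carrier)
    then show "x \<otimes>\<^bsub>RDirProd A B\<^esub> y = y \<otimes>\<^bsub>RDirProd A B\<^esub> x"
      by (auto simp: RDirProd_ops A.m_comm B.m_comm)
  qed
  then show ?thesis
    using P.subcring_iff[OF subringE(1)[OF sub]] by (simp add: amalgamation_def)
qed

lemma fst_amalgamation:
  assumes "ideal J B"
  shows "fst \<in> ring_hom (amalgamation A B f J) A"
    and "fst ` carrier (amalgamation A B f J) = carrier A"
proof -
  interpret J: ideal J B by fact
  show "fst \<in> ring_hom (amalgamation A B f J) A"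
    by (rule ring_hom_memI) (auto simp: amalgamation_def RDirProd_ops)
  show "fst ` carrier (amalgamation A B f J) = carrier A"
    using J.zero_closed by (auto simp: amalgamation_def image_def intro: exI[of _ "\<zero>\<^bsub>B\<^esub>"])
qed

lemma snd_amalgamation:
  "snd \<in> ring_hom (amalgamation A B f J) (image_plus_ideal A B f J)"
  "snd ` carrier (amalgamation A B f J) = carrier (image_plus_ideal A B f J)"
proof -
  show "snd \<in> ring_hom (amalgamation A B f J) (image_plus_ideal A B f J)"
    by (rule ring_hom_memI; auto simp: amalgamation_def image_plus_ideal_def RDirProd_ops; blast)
  show "snd ` carrier (amalgamation A B f J) = carrier (image_plus_ideal A B f J)"
    by (simp add: amalgamation_def image_plus_ideal_def image_def)
qed

theorem theorem3p1:
  fixes A :: "('a, 'm) ring_scheme" and B :: "('b, 'n) ring_scheme"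
    and J :: "'b set" and f :: "'a \<Rightarrow> 'b"
  assumes "cring A" and "cring B" and "ideal J B" and "f \<in> ring_hom A B"
  shows "SFT_ring (amalgamation A B f J) \<longleftrightarrow>
    SFT_ring A \<and> SFT_ring (image_plus_ideal A B f J)"
proof
  note fst_R = fst_amalgamation[OF \<open>ideal J B\<close>]
  assume R: "SFT_ring (amalgamation A B f J)"
  show "SFT_ring A \<and> SFT_ring (image_plus_ideal A B f J)"
    using SFT_ring_surjective_image[OF R \<open>cring A\<close> fst_R]
      SFT_ring_surjective_image[OF R cring_image_plus_ideal[OF assms] snd_amalgamation]
    by blast
next
  assume AC: "SFT_ring A \<and> SFT_ring (image_plus_ideal A B f J)"
  interpret A: cring A by fact
  interpret B: cring B by fact
  show "SFT_ring (amalgamation A B f J)"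
  proof (rule SFT_ring_if_kernels_annihilate[OF cring_amalgamation[OF assms]
        conjunct1[OF AC] conjunct2[OF AC] fst_amalgamation[OF \<open>ideal J B\<close>] snd_amalgamation])
    \<comment> \<open>The errors have the form \<open>u = (0, j)\<close> and \<open>v = (a, 0)\<close>.\<close>
    fix u v
    assume uv: "u \<in> carrier (amalgamation A B f J)" "v \<in> carrier (amalgamation A B f J)"
      and zero: "fst u = \<zero>\<^bsub>A\<^esub>" "snd v = \<zero>\<^bsub>image_plus_ideal A B f J\<^esub>"
    have "u \<in> carrier A \<times> carrier B" "v \<in> carrier A \<times> carrier B"
      using uv subringE(1)[OF subring_amalgamation[OF assms]]
      by (auto simp: RDirProd_carrier)
    then show "u \<otimes>\<^bsub>amalgamation A B f J\<^esub> v = \<zero>\<^bsub>amalgamation A B f J\<^esub>"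
      using zero by (auto simp: amalgamation_def image_plus_ideal_def RDirProd_ops)
  qed
qed

end
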